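(* Let $n\ge 2$ and let $x_{1}>x_{2}\geq\cdots\geq x_{n-1}>x_{n}$ be real numbers (for $n=2$ this means $x_1>x_2$). Set $\bar{x}=\frac{1}{n}\sum_{i=1}^{n}x_{i}$. For real $\lambda\neq 0$ and real $\tau$ with $\lambda x_i+\tau>0$ for all $1\le i\le n$, define $$ F(\lambda,\tau)=\frac{1}{2n\lambda^{2}}\left\{\sum_{i=1}^{n}\ln(\lambda x_{i}+\tau)\right\}^{2}-\frac{1}{2\lambda^{2}}\sum_{i=1}^{n}\bigl\{\ln(\lambda x_{i}+\tau)\bigr\}^{2}-\sum_{i=1}^{n}\ln(\lambda x_{i}+\tau). $$ Define $$ \tau_{U}^{+}(\lambda)=-\lambda\,\frac{x_{n}-\bar{x}\,e^{-\lambda^{2}}}{1-e^{-\lambda^{2}}}\quad\text{for }\lambda>0,\qquad \tau_{U}^{-}(\lambda)=-\lambda\,\frac{x_{1}-\bar{x}\,e^{-\lambda^{2}}}{1-e^{-\lambda^{2}}}\quad\text{for }\lambda<0. $$ Then the following statements hold. 1) $\dfrac{\partial F}{\partial\tau}\bigl(\lambda,\tau_{U}^{+}(\lambda)\bigr)<0$ for every $\lambda>0$, and $\dfrac{\partial F}{\partial\tau}\bigl(\lambda,\tau_{U}^{-}(\lambda)\bigr)<0$ for every $\lambda<0$. 2) $\displaystyle\lim_{\tau\to-\lambda x_{n}+0}\frac{\partial F}{\partial\tau}(\lambda,\tau)=+\infty$ for every $\lambda>0$, and $\displaystyle\lim_{\tau\to-\lambda x_{1}+0}\frac{\partial F}{\partial\tau}(\lambda,\tau)=+\infty$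 for every $\lambda<0$. 3) $\dfrac{\partial F}{\partial\tau}(\lambda,\tau)<0$ for any point $(\lambda,\tau)$ of the domain of $F$ that satisfies $\dfrac{\partial^{2}F}{\partial\tau^{2}}(\lambda,\tau)=0$. 4) $\displaystyle\lim_{\lambda\to+\infty}F\bigl(\lambda,\tau_{U}^{+}(\lambda)\bigr)=+\infty$ and $\displaystyle\lim_{\lambda\to-\infty}F\bigl(\lambda,\tau_{U}^{-}(\lambda)\bigr)=+\infty$. 5) The function $F_{0}(\tau)=\displaystyle\lim_{\lambda\to\pm 0}F(\lambda,\tau)$, $\tau>0$ (the limit as $\lambda\to 0$ from either side, with $\tau$ fixed), achieves the relative maximum when $$ \tau=\tau^{\ast}=\frac{1}{n}\sqrt{\sum_{i=1}^{n-1}\sum_{j=i+1}^{n}(x_{i}-x_{j})^{2}}. $$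
   Context: Here $\ln$ is the natural logarithm. The numbers $x_1,\dots,x_n$ are the observed data, with the ordering $x_{1}>x_{2}\geq\cdots\geq x_{n-1}>x_{n}$. The domain of $F$ is the set of $(\lambda,\tau)\in\mathbb{R}^2$ with $\lambda\neq0$ and $\lambda x_i+\tau>0$ for all $i$; for $\lambda>0$ this means $\tau>-\lambda x_n$, and for $\lambda<0$ it means $\tau>-\lambda x_1$. The notation $\tau\to a+0$ denotes the limit as $\tau$ decreases to $a$. For a fixed $\tau>0$, the pair $(\lambda,\tau)$ lies in the domain of $F$ for all sufficiently small $|\lambda|\neq 0$. *)

theory Defs
  imports "HOL-Analysis.Analysis"
begin

text \<open>The data are \<open>x 1, \<dots>, x n\<close>; values of \<open>x\<close> outside \<open>{1..n}\<close> are irrelevant.\<close>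

definition ordered_data :: "nat \<Rightarrow> (nat \<Rightarrow> real) \<Rightarrow> bool" where
  "ordered_data n x \<longleftrightarrow>
     x 1 > x 2 \<and> (\<forall>i. 2 \<le> i \<and> i + 1 \<le> n - 1 \<longrightarrow> x i \<ge> x (i + 1)) \<and> x (n - 1) > x n"

definition xbar :: "nat \<Rightarrow> (nat \<Rightarrow> real) \<Rightarrow> real" where
  "xbar n x = (1 / real n) * (\<Sum>i = 1..n. x i)"

definition F_domain :: "nat \<Rightarrow> (nat \<Rightarrow> real) \<Rightarrow> (real \<times> real) set" where
  "F_domain n x = {(l, t). l \<noteq> 0 \<and> (\<forall>i \<in> {1..n}. l * x i + t > 0)}"

text \<open>Only the values on \<open>F_domain n x\<close> are meaningful. For fixed \<open>l\<close> the section of the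
  domain is open in \<open>t\<close>, so \<open>t\<close>-derivatives at its points do not see values outside it.\<close>

definition F :: "nat \<Rightarrow> (nat \<Rightarrow> real) \<Rightarrow> real \<Rightarrow> real \<Rightarrow> real" where
  "F n x l t =
     1 / (2 * real n * l\<^sup>2) * (\<Sum>i = 1..n. ln (l * x i + t))\<^sup>2
     - 1 / (2 * l\<^sup>2) * (\<Sum>i = 1..n. (ln (l * x i + t))\<^sup>2)
     - (\<Sum>i = 1..n. ln (l * x i + t))"

definition dF :: "nat \<Rightarrow> (nat \<Rightarrow> real) \<Rightarrow> real \<Rightarrow> real \<Rightarrow> real" where
  "dF n x l t = deriv (F n x l) t"

definition ddF :: "nat \<Rightarrow> (nat \<Rightarrow> real) \<Rightarrow> real \<Rightarrow> real \<Rightarrow> real" where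
  "ddF n x l t = deriv (dF n x l) t"

definition tau_U_plus :: "nat \<Rightarrow> (nat \<Rightarrow> real) \<Rightarrow> real \<Rightarrow> real" where
  "tau_U_plus n x l = - l * ((x n - xbar n x * exp (- l\<^sup>2)) / (1 - exp (- l\<^sup>2)))"

definition tau_U_minus :: "nat \<Rightarrow> (nat \<Rightarrow> real) \<Rightarrow> real \<Rightarrow> real" where
  "tau_U_minus n x l = - l * ((x 1 - xbar n x * exp (- l\<^sup>2)) / (1 - exp (- l\<^sup>2)))"

text \<open>\<open>Lim\<close> is a description operator: it is the limit only where the limit exists.\<close>

definition F0 :: "nat \<Rightarrow> (nat \<Rightarrow> real) \<Rightarrow> real \<Rightarrow> real" where
  "F0 n x t = Lim (at 0) (\<lambda>l. F n x l t)"

definition tau_star :: "nat \<Rightarrow> (nat \<Rightarrow> real) \<Rightarrow> real" where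
  "tau_star n x = 1 / real n * sqrt (\<Sum>i = 1..n - 1. \<Sum>j = i + 1..n. (x i - x j)\<^sup>2)"

definition relative_max_at :: "real set \<Rightarrow> (real \<Rightarrow> real) \<Rightarrow> real \<Rightarrow> bool" where
  "relative_max_at S f a \<longleftrightarrow>
     a \<in> S \<and> (\<exists>d > 0. \<forall>t \<in> S. \<bar>t - a\<bar> < d \<longrightarrow> f t \<le> f a)"

end

theory Submission
  imports Defs "HOL-Real_Asymp.Real_Asymp"
begin

text \<open>Up to a factor, the quadratic part of \<open>F\<close> is the sum of squares of the
  \<open>L i = ln (l * x i + t)\<close> about their mean, hence invariant under a common scaling of the
  arguments. Writing \<open>y i = l * x i + t\<close> and \<open>m\<close> for the mean of the \<open>L i\<close>, the derivative of
  \<open>F\<close> in \<open>t\<close> is \<open>(\<Sum>i. (m - l\<^sup>2 - L i) / y i) / l\<^sup>2\<close>. The point \<open>\<tau>\<^sub>U\<close> is the one at which the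
  smallest \<open>y i\<close> equals \<open>exp (- l\<^sup>2)\<close> times the mean of the \<open>y i\<close>, so by the inequality of
  arithmetic and geometric means every term is negative there. At a zero of the second
  derivative put \<open>w i = 1 / y i\<close> and \<open>a i = L i - m + l\<^sup>2 = c - ln (w i)\<close>; then
  \<open>\<Sum>i. a i * (w i)\<^sup>2 > 0\<close> by Cauchy-Schwarz, and \<open>a i * (w i - exp c) \<le> 0\<close> gives
  \<open>\<Sum>i. a i * w i > 0\<close>. The case \<open>l < 0\<close> reduces to \<open>l > 0\<close> by replacing \<open>x\<close> with \<open>- x\<close>.\<close>

section \<open>Sums of squares about the mean\<close>

definition centered_ss :: "nat \<Rightarrow> (nat \<Rightarrow> real) \<Rightarrow> real" where
  "centered_ss n z = (\<Sum>i = 1..n. (z i)\<^sup>2) - (\<Sum>i = 1..n. z i)\<^sup>2 / real n"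

text \<open>The expanded form in the definition is the one that occurs in \<open>F\<close>; this
  deviation form yields shift invariance and positivity.\<close>

lemma centered_ss_eq_sum_squares:
  assumes "n > 0"
  shows "centered_ss n z = (\<Sum>i = 1..n. (z i - (\<Sum>j = 1..n. z j) / real n)\<^sup>2)"
proof -
  define m where "m = (\<Sum>j = 1..n. z j) / real n"
  have S: "(\<Sum>j = 1..n. z j) = real n * m"
    using assms by (simp add: m_def)
  have "(\<Sum>i = 1..n. (z i - m)\<^sup>2) = (\<Sum>i = 1..n. (z i)\<^sup>2 + m\<^sup>2 - 2 * m * z i)"
    by (simp add: power2_diff mult_ac)
  also have "\<dots> = (\<Sum>i = 1..n. (z i)\<^sup>2) + real n * m\<^sup>2 - 2 * m * (\<Sum>i = 1..n. z i)"
    by (simp add: sum.distrib sum_subtractf sum_distrib_left)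
  also have "\<dots> = centered_ss n z"
    unfolding centered_ss_def S using assms by (simp add: power2_eq_square field_simps)
  finally show ?thesis
    by (simp add: m_def)
qed

lemma centered_ss_shift:
  assumes "n > 0"
  shows "centered_ss n (\<lambda>i. c + z i) = centered_ss n z"
  using assms by (simp add: centered_ss_eq_sum_squares sum.distrib add_divide_distrib)

lemma centered_ss_scale: "centered_ss n (\<lambda>i. c * z i) = c\<^sup>2 * centered_ss n z"
  by (simp add: centered_ss_def sum_distrib_left [symmetric] power_mult_distrib algebra_simps)

lemma centered_ss_cong:
  assumes "\<And>i. i \<in> {1..n} \<Longrightarrow> z i = z' i"
  shows "centered_ss n z = centered_ss n z'"
proof -
  have "(\<Sum>i = 1..n. z i) = (\<Sum>i = 1..n. z' i)" "(\<Sum>i = 1..n. (z i)\<^sup>2) = (\<Sum>i = 1..n. (z' i)\<^sup>2)"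
    using assms by (auto intro!: sum.cong)
  then show ?thesis
    by (simp add: centered_ss_def)
qed

lemma centered_ss_pos:
  assumes "n > 0" "i \<in> {1..n}" "j \<in> {1..n}" "z i \<noteq> z j"
  shows "centered_ss n z > 0"
proof -
  define m where "m = (\<Sum>j = 1..n. z j) / real n"
  obtain k where k: "k \<in> {1..n}" "z k \<noteq> m"
    using assms by metis
  have "0 < (\<Sum>i = 1..n. (z i - m)\<^sup>2)"
    by (rule sum_pos2 [of _ k]) (use k in auto)
  then show ?thesis
    using assms(1) by (simp add: centered_ss_eq_sum_squares m_def)
qed

text \<open>A case of Lagrange's identity. The right side is \<open>n\<close> times
  \<open>centered_ss n z\<close>, which ties the pair sum inside \<open>tau_star\<close> to the
  spread of the data.\<close>

lemma sum_pairs_square_diff: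
  "(\<Sum>i = 1..n. \<Sum>j = i + 1..n. (z i - z j)\<^sup>2) =
     real n * (\<Sum>i = 1..n. (z i)\<^sup>2) - (\<Sum>i = 1..n. z i :: real)\<^sup>2"
proof (induction n)
  case 0
  then show ?case by simp
next
  case (Suc n)
  \<comment> \<open>The inner sum for \<open>i = Suc n\<close> is empty, and each earlier
    \<open>i\<close> gains only the pair with \<open>Suc n\<close>.\<close>
  have "(\<Sum>i = 1..Suc n. \<Sum>j = i + 1..Suc n. (z i - z j)\<^sup>2) =
        (\<Sum>i = 1..n. (\<Sum>j = i + 1..n. (z i - z j)\<^sup>2) + (z i - z (Suc n))\<^sup>2)"
    by simp
  also have "\<dots> = (\<Sum>i = 1..n. \<Sum>j = i + 1..n. (z i - z j)\<^sup>2) +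
      (\<Sum>i = 1..n. (z i)\<^sup>2 + (z (Suc n))\<^sup>2 - 2 * z (Suc n) * z i)"
    by (simp add: sum.distrib power2_diff mult_ac)
  also have "(\<Sum>i = 1..n. (z i)\<^sup>2 + (z (Suc n))\<^sup>2 - 2 * z (Suc n) * z i) =
      (\<Sum>i = 1..n. (z i)\<^sup>2) + real n * (z (Suc n))\<^sup>2 - 2 * z (Suc n) * (\<Sum>i = 1..n. z i)"
    by (simp add: sum.distrib sum_subtractf sum_distrib_left)
  finally show ?case
    using Suc.IH by (simp add: power2_eq_square algebra_simps)
qed

lemma tau_star_square:
  assumes "n > 0"
  shows "(tau_star n x)\<^sup>2 = centered_ss n x / real n"
proof -
  \<comment> \<open>The extra index \<open>i = n\<close> contributes an empty inner sum.\<close>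
  have "(\<Sum>i = 1..n. \<Sum>j = i + 1..n. (x i - x j)\<^sup>2) =
        (\<Sum>i = 1..n - 1. \<Sum>j = i + 1..n. (x i - x j)\<^sup>2)"
    by (rule sum.mono_neutral_right) auto
  then have "(\<Sum>i = 1..n - 1. \<Sum>j = i + 1..n. (x i - x j)\<^sup>2) = real n * centered_ss n x"
    using assms sum_pairs_square_diff [of x n] by (simp add: centered_ss_def algebra_simps)
  moreover have "(\<Sum>i = 1..n - 1. \<Sum>j = i + 1..n. (x i - x j)\<^sup>2) \<ge> 0"
    by (intro sum_nonneg) simp
  ultimately show ?thesis
    using assms by (simp add: tau_star_def power_mult_distrib power_divide power2_eq_square)
qed

section \<open>Rewriting F and extracting a common scale\<close>

lemma F_eq_centered_ss:
  "F n x l t = - centered_ss n (\<lambda>i. ln (l * x i + t)) / (2 * l\<^sup>2) - (\<Sum>i = 1..n. ln (l * x i + t))"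
  \<comment> \<open>For \<open>l = 0\<close> or \<open>n = 0\<close>, division by zero returns 0 and
    the quadratic part vanishes on both sides.\<close>
  by (cases "l = 0"; cases "n = 0") (simp_all add: F_def centered_ss_def field_simps)

text \<open>A common factor \<open>s\<close> shifts all logarithms equally, so it survives only in
  the linear part. It is applied with the mean of the arguments as \<open>s\<close> along
  \<open>tau_U\<close>, and with \<open>s = t\<close> as \<open>l\<close> tends to 0.\<close>

lemma F_scaled:
  assumes "n > 0" "s > 0" "\<And>i. i \<in> {1..n} \<Longrightarrow> r i > 0" "\<And>i. i \<in> {1..n} \<Longrightarrow> l * x i + t = s * r i"
  shows "F n x l t = - centered_ss n (\<lambda>i. ln (r i)) / (2 * l\<^sup>2) - real n * ln s - (\<Sum>i = 1..n. ln (r i))"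
proof -
  have L: "ln (l * x i + t) = ln s + ln (r i)" if "i \<in> {1..n}" for i
    using assms(2) assms(3) [OF that] assms(4) [OF that] by (simp add: ln_mult)
  have "centered_ss n (\<lambda>i. ln (l * x i + t)) = centered_ss n (\<lambda>i. ln s + ln (r i))"
    by (rule centered_ss_cong) (rule L)
  moreover have "(\<Sum>i = 1..n. ln (l * x i + t)) = (\<Sum>i = 1..n. ln s + ln (r i))"
    by (rule sum.cong) (use L in auto)
  ultimately show ?thesis
    using assms(1) by (simp add: F_eq_centered_ss centered_ss_shift sum.distrib)
qed

section \<open>First and second derivatives in t\<close>

text \<open>A closed form for \<open>dF\<close> on the domain, given a name so that it can be
  differentiated again and its limits computed.\<close>

definition score :: "nat \<Rightarrow> (nat \<Rightarrow> real) \<Rightarrow> real \<Rightarrow> real \<Rightarrow> real" where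
  "score n x l t =
     (\<Sum>i = 1..n. ((\<Sum>j = 1..n. ln (l * x j + t)) / real n - l\<^sup>2 - ln (l * x i + t)) / (l * x i + t)) / l\<^sup>2"

lemma F_has_derivative_score:
  assumes "n > 0" "(l, t) \<in> F_domain n x"
  shows "(F n x l has_real_derivative score n x l t) (at t)"
proof -
  have l: "l \<noteq> 0" and pos: "\<And>i. i \<in> {1..n} \<Longrightarrow> l * x i + t > 0"
    using assms(2) by (auto simp: F_domain_def)
  define S where "S = (\<Sum>j = 1..n. ln (l * x j + t))"
  define W where "W = (\<Sum>j = 1..n. 1 / (l * x j + t))"
  define Q where "Q = (\<Sum>j = 1..n. ln (l * x j + t) / (l * x j + t))"
  have dS: "((\<lambda>t. \<Sum>i = 1..n. ln (l * x i + t)) has_real_derivative W) (at t)"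
    unfolding W_def by (auto intro!: derivative_eq_intros simp: pos)
  have dQ: "((\<lambda>t. \<Sum>i = 1..n. (ln (l * x i + t))\<^sup>2) has_real_derivative 2 * Q) (at t)"
    unfolding Q_def sum_distrib_left by (auto intro!: derivative_eq_intros sum.cong simp: pos)
  have "((\<lambda>t. 1 / (2 * real n * l\<^sup>2) * (\<Sum>i = 1..n. ln (l * x i + t))\<^sup>2
     - 1 / (2 * l\<^sup>2) * (\<Sum>i = 1..n. (ln (l * x i + t))\<^sup>2)
     - (\<Sum>i = 1..n. ln (l * x i + t))) has_real_derivative
     1 / (2 * real n * l\<^sup>2) * (2 * S * W) - 1 / (2 * l\<^sup>2) * (2 * Q) - W) (at t)"
    by (rule derivative_eq_intros dS dQ refl | simp add: S_def)+
  moreover have "score n x l t =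
      (\<Sum>i = 1..n. (S / real n - l\<^sup>2) * (1 / (l * x i + t)) - ln (l * x i + t) / (l * x i + t)) / l\<^sup>2"
    unfolding score_def S_def [symmetric] by (simp add: diff_divide_distrib)
  then have "score n x l t = ((S / real n - l\<^sup>2) * W - Q) / l\<^sup>2"
    unfolding sum_subtractf sum_distrib_left [symmetric] W_def Q_def .
  then have "1 / (2 * real n * l\<^sup>2) * (2 * S * W) - 1 / (2 * l\<^sup>2) * (2 * Q) - W = score n x l t"
    using l assms(1) by (simp add: field_simps)
  ultimately show ?thesis
    by (simp add: F_def [abs_def])
qed

lemma dF_eq_score:
  assumes "n > 0" "(l, t) \<in> F_domain n x"
  shows "dF n x l t = score n x l t"
  unfolding dF_def by (rule DERIV_imp_deriv) (rule F_has_derivative_score [OF assms])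

text \<open>\<open>dF\<close> is identified with \<open>score\<close> at points of the domain only.
  Openness of the sections gives agreement on a neighbourhood of \<open>t\<close>, which the second
  derivative requires.\<close>

lemma eventually_F_domain:
  assumes "(l, t) \<in> F_domain n x"
  shows "eventually (\<lambda>s. (l, s) \<in> F_domain n x) (nhds t)"
proof -
  have "eventually (\<lambda>s. l * x i + s > 0) (nhds t)" if "i \<in> {1..n}" for i
  proof -
    have "((\<lambda>s. l * x i + s) \<longlongrightarrow> l * x i + t) (nhds t)"
      by (intro tendsto_intros filterlim_ident)
    moreover have "l * x i + t > 0"
      using assms that by (auto simp: F_domain_def)
    ultimately show ?thesis
      by (rule order_tendstoD)
  qed
  then have "eventually (\<lambda>s. \<forall>i\<in>{1..n}. l * x i + s > 0) (nhds t)"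
    by (intro eventually_ball_finite) auto
  then show ?thesis
    using assms by (auto simp: F_domain_def)
qed

text \<open>Put w i = 1 / y i. Differentiating the mean of the logarithms gives (sum of w)^2 / n,
  and differentiating each \<open>ln (y i)\<close> gives minus the sum of the (w i)^2. Together
  these are minus the \<open>centered_ss\<close> of w, whose sign is known.\<close>

lemma ddF_eq:
  assumes "n > 0" "(l, t) \<in> F_domain n x"
  defines "y \<equiv> \<lambda>i. l * x i + t"
  defines "m \<equiv> (\<Sum>j = 1..n. ln (y j)) / real n"
  shows "ddF n x l t =
    ((\<Sum>i = 1..n. (ln (y i) - m + l\<^sup>2) * (1 / y i)\<^sup>2) - centered_ss n (\<lambda>i. 1 / y i)) / l\<^sup>2"
proof -
  have pos: "\<And>i. i \<in> {1..n} \<Longrightarrow> y i > 0"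
    using assms(2) by (auto simp: F_domain_def y_def)
  define W where "W = (\<Sum>j = 1..n. 1 / y j)"
  have ev: "eventually (\<lambda>s. dF n x l s = score n x l s) (nhds t)"
    using eventually_F_domain [OF assms(2)] by eventually_elim (rule dF_eq_score [OF assms(1)])
  have dm: "((\<lambda>t. (\<Sum>j = 1..n. ln (l * x j + t)) / real n) has_real_derivative W / real n) (at t)"
    unfolding W_def y_def using pos assms(1) by (auto intro!: derivative_eq_intros simp: y_def)
  have "((\<lambda>t. ((\<Sum>j = 1..n. ln (l * x j + t)) / real n - l\<^sup>2 - ln (l * x i + t)) / (l * x i + t))
     has_real_derivative (W / real n - 1 / y i) / y i - (m - l\<^sup>2 - ln (y i)) * (1 / y i)\<^sup>2) (at t)"
    (is "(_ has_real_derivative ?d i) _") if "i \<in> {1..n}" for i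
  proof -
    have y: "y i > 0" and dy: "((\<lambda>t. l * x i + t) has_real_derivative 1) (at t)"
      using pos [OF that] by (auto intro!: derivative_eq_intros)
    have dL: "((\<lambda>t. ln (l * x i + t)) has_real_derivative 1 / y i) (at t)"
      using y by (auto intro!: derivative_eq_intros simp: y_def)
    have "l * x i + t \<noteq> 0"
      using y by (simp add: y_def)
    note DERIV_divide [OF DERIV_diff [OF DERIV_diff [OF dm DERIV_const [of "l\<^sup>2"]] dL] dy this]
    moreover have "((W / real n - 0 - 1 / y i) * (l * x i + t)
        - ((\<Sum>j = 1..n. ln (l * x j + t)) / real n - l\<^sup>2 - ln (l * x i + t)) * 1)
        / ((l * x i + t) * (l * x i + t)) = ?d i"
      using y unfolding m_def y_def by (simp add: diff_divide_distrib power2_eq_square)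
    ultimately show ?thesis
      by simp
  qed
  then have "(score n x l has_real_derivative (\<Sum>i = 1..n. ?d i) / l\<^sup>2) (at t)"
    unfolding score_def [abs_def] by (intro DERIV_sum DERIV_cdivide)
  then have "deriv (score n x l) t = (\<Sum>i = 1..n. ?d i) / l\<^sup>2"
    by (rule DERIV_imp_deriv)
  then have "ddF n x l t = (\<Sum>i = 1..n. ?d i) / l\<^sup>2"
    unfolding ddF_def deriv_cong_ev [OF ev refl] .
  also have "(\<Sum>i = 1..n. ?d i) =
     (\<Sum>i = 1..n. W / real n * (1 / y i) - (1 / y i)\<^sup>2 + (ln (y i) - m + l\<^sup>2) * (1 / y i)\<^sup>2)"
  proof (rule sum.cong [OF refl])
    fix i
    have "(W / real n - v) * v - (m - l\<^sup>2 - L) * v\<^sup>2 = W / real n * v - v\<^sup>2 + (L - m + l\<^sup>2) * v\<^sup>2" for v L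
      by algebra
    from this [of "1 / y i" "ln (y i)"]
    show "?d i = W / real n * (1 / y i) - (1 / y i)\<^sup>2 + (ln (y i) - m + l\<^sup>2) * (1 / y i)\<^sup>2"
      by simp
  qed
  also have "\<dots> = W / real n * W - (\<Sum>i = 1..n. (1 / y i)\<^sup>2)
       + (\<Sum>i = 1..n. (ln (y i) - m + l\<^sup>2) * (1 / y i)\<^sup>2)"
    unfolding sum.distrib sum_subtractf sum_distrib_left [symmetric] W_def ..
  finally show ?thesis
    by (simp add: centered_ss_def W_def power2_eq_square)
qed

section \<open>Sign of the derivative at zeros of the second derivative\<close>

lemma score_neg_if_ddF_zero:
  assumes "n > 0" "(l, t) \<in> F_domain n x" "i \<in> {1..n}" "j \<in> {1..n}" "x i \<noteq> x j"
    and "ddF n x l t = 0"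
  shows "score n x l t < 0"
proof -
  define y where "y = (\<lambda>i. l * x i + t)"
  define m where "m = (\<Sum>j = 1..n. ln (y j)) / real n"
  define a where "a = (\<lambda>i. ln (y i) - m + l\<^sup>2)"
  \<comment> \<open>This \<open>c\<close> is already exponentiated: it is the \<open>exp c\<close>
    of the overview, chosen so that \<open>a i = ln (c * y i)\<close>.\<close>
  define c where "c = exp (l\<^sup>2 - m)"
  have l: "l \<noteq> 0" and pos: "\<And>i. i \<in> {1..n} \<Longrightarrow> y i > 0"
    using assms(2) by (auto simp: F_domain_def y_def)
  have "y i \<noteq> y j"
    using assms(5) l by (simp add: y_def)
  then have "centered_ss n (\<lambda>i. 1 / y i) > 0"
    using centered_ss_pos [OF assms(1,3,4), of "\<lambda>i. 1 / y i"] by simp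
  then have "0 < (\<Sum>i = 1..n. a i * (1 / y i)\<^sup>2)"
    using ddF_eq [OF assms(1,2)] assms(6) l unfolding a_def m_def y_def by simp
  also have "\<dots> \<le> (\<Sum>i = 1..n. c * (a i * (1 / y i)))"
  proof (rule sum_mono)
    fix i assume i: "i \<in> {1..n}"
    have w: "1 / y i > 0"
      using pos [OF i] by simp
    have a: "a i = ln (c * y i)"
      using pos [OF i] by (simp add: a_def c_def ln_mult)
    \<comment> \<open>Both factors change sign exactly at \<open>c * y i = 1\<close>, in opposite
      directions.\<close>
    have "a i * (1 / y i - c) \<le> 0"
    proof (cases "c * y i \<ge> 1")
      case True
      then have "a i \<ge> 0"
        by (simp add: a)
      moreover have "1 / y i \<le> c"
        using True pos [OF i] by (simp add: field_simps)
      ultimately show ?thesis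
        by (simp add: mult_nonneg_nonpos)
    next
      case False
      moreover have "c * y i > 0"
        using pos [OF i] by (simp add: c_def)
      ultimately have "a i \<le> 0" "1 / y i \<ge> c"
        using pos [OF i] by (auto simp: a field_simps)
      then show ?thesis
        by (simp add: mult_nonpos_nonneg)
    qed
    then have "(1 / y i) * (a i * (1 / y i - c)) \<le> 0"
      by (rule mult_nonneg_nonpos [OF less_imp_le [OF w]])
    then show "a i * (1 / y i)\<^sup>2 \<le> c * (a i * (1 / y i))"
      by (simp add: power2_eq_square algebra_simps)
  qed
  finally have "0 < c * (\<Sum>i = 1..n. a i * (1 / y i))"
    by (simp add: sum_distrib_left)
  then have "0 < (\<Sum>i = 1..n. a i * (1 / y i))"
    by (simp add: c_def zero_less_mult_iff)
  also have "\<dots> = (\<Sum>i = 1..n. - ((m - l\<^sup>2 - ln (y i)) / y i))"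
    by (rule sum.cong) (simp_all add: a_def diff_divide_distrib add_divide_distrib)
  also have "\<dots> = - (l\<^sup>2 * score n x l t)"
    using l unfolding sum_negf score_def m_def y_def by simp
  finally show ?thesis
    using l by (simp add: mult_less_0_iff)
qed

section \<open>The curve tau_U and the sign of the derivative on it\<close>

text \<open>\<open>tau_U_plus\<close> and \<open>tau_U_minus\<close> are the instances \<open>k = n\<close> and \<open>k = 1\<close>.\<close>

definition tau_U :: "nat \<Rightarrow> (nat \<Rightarrow> real) \<Rightarrow> nat \<Rightarrow> real \<Rightarrow> real" where
  "tau_U n x k l = - l * ((x k - xbar n x * exp (- l\<^sup>2)) / (1 - exp (- l\<^sup>2)))"

text \<open>Strictness ensures that for \<open>l > 0\<close> exactly one argument of the logarithms
  tends to 0 at the left end of the domain, and that exactly one normalised argument decays along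
  \<open>tau_U\<close>.\<close>

definition strict_min_index :: "nat \<Rightarrow> (nat \<Rightarrow> real) \<Rightarrow> nat \<Rightarrow> bool" where
  "strict_min_index n x k \<longleftrightarrow> k \<in> {1..n} \<and> (\<forall>i\<in>{1..n} - {k}. x k < x i)"

lemma strict_min_index_less_xbar:
  assumes "n \<ge> 2" "strict_min_index n x k"
  shows "x k < xbar n x"
proof -
  have k: "k \<in> {1..n}" and less: "\<And>i. i \<in> {1..n} - {k} \<Longrightarrow> x k < x i"
    using assms(2) by (auto simp: strict_min_index_def)
  have "card ({1..n} - {k}) > 0"
    using assms(1) k by simp
  then have ne: "{1..n} - {k} \<noteq> {}"
    by (metis card.empty less_numeral_extra(3))
  then obtain j where j: "j \<in> {1..n} - {k}"
    by blast
  have "real n * x k = (\<Sum>i = 1..n. x k)"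
    by simp
  also have "\<dots> < (\<Sum>i = 1..n. x i)"
  proof (rule sum_strict_mono_ex1)
    show "\<forall>i\<in>{1..n}. x k \<le> x i"
      using less by (metis DiffI less_imp_le order_refl singletonD)
    show "\<exists>i\<in>{1..n}. x k < x i"
      using j less by blast
  qed simp
  finally show ?thesis
    using assms(1) by (simp add: xbar_def field_simps)
qed

text \<open>\<open>rel_arg n x k l i\<close> is the quotient of \<open>l * x i + tau_U n x k l\<close> by the mean of these
  numbers.\<close>

definition rel_arg :: "nat \<Rightarrow> (nat \<Rightarrow> real) \<Rightarrow> nat \<Rightarrow> real \<Rightarrow> nat \<Rightarrow> real" where
  "rel_arg n x k l i = exp (- l\<^sup>2) + (1 - exp (- l\<^sup>2)) * ((x i - x k) / (xbar n x - x k))"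

text \<open>The scale \<open>s\<close> is the mean of the arguments,
  \<open>l * xbar n x + tau_U n x k l\<close>, in simplified form. The second claim is verified
  after multiplying by \<open>1 - exp (- l\<^sup>2)\<close>, which is positive, to clear
  denominators.\<close>

lemma tau_U_scaling:
  assumes "l > 0" "x k < xbar n x"
  defines "s \<equiv> l * (xbar n x - x k) / (1 - exp (- l\<^sup>2))"
  shows "s > 0" and "l * x i + tau_U n x k l = s * rel_arg n x k l i"
proof -
  define e where "e = exp (- l\<^sup>2)"
  define d where "d = xbar n x - x k"
  have e: "e < 1" and d: "d > 0"
    using assms(1,2) by (simp_all add: e_def d_def)
  show "s > 0"
    using assms(1,2) e by (simp add: s_def e_def)
  have s: "s * (1 - e) = l * d"
    using e by (simp add: s_def e_def d_def)
  have "tau_U n x k l * (1 - e) = - l * (x k - xbar n x * e)"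
    using e by (simp add: tau_U_def e_def)
  then have "(l * x i + tau_U n x k l) * (1 - e) = l * (d * e + (1 - e) * (x i - x k))"
    unfolding d_def by (simp add: algebra_simps)
  also have "\<dots> = l * d * (e + (1 - e) * ((x i - x k) / d))"
    using d by (simp add: field_simps)
  also have "\<dots> = s * rel_arg n x k l i * (1 - e)"
    unfolding s [symmetric] rel_arg_def e_def [symmetric] d_def [symmetric] by (simp only: mult_ac)
  finally show "l * x i + tau_U n x k l = s * rel_arg n x k l i"
    using e by simp
qed

lemma rel_arg_facts:
  assumes "n \<ge> 2" "strict_min_index n x k" "l > 0"
  shows rel_arg_self: "rel_arg n x k l k = exp (- l\<^sup>2)"
    and rel_arg_ge: "\<And>i. i \<in> {1..n} \<Longrightarrow> exp (- l\<^sup>2) \<le> rel_arg n x k l i"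
    and rel_arg_pos: "\<And>i. i \<in> {1..n} \<Longrightarrow> 0 < rel_arg n x k l i"
    and sum_rel_arg: "(\<Sum>i = 1..n. rel_arg n x k l i) = real n"
proof -
  have less: "x k < xbar n x"
    using strict_min_index_less_xbar assms(1,2) by blast
  show "rel_arg n x k l k = exp (- l\<^sup>2)"
    by (simp add: rel_arg_def)
  show ge: "exp (- l\<^sup>2) \<le> rel_arg n x k l i" if "i \<in> {1..n}" for i
  proof -
    have "x k \<le> x i"
      using assms(2) that unfolding strict_min_index_def
      by (metis DiffI less_imp_le order_refl singletonD)
    then show ?thesis
      using less by (simp add: rel_arg_def)
  qed
  show "0 < rel_arg n x k l i" if "i \<in> {1..n}" for i
    using ge [OF that] by (rule less_le_trans [OF exp_gt_zero])
  have "(\<Sum>i = 1..n. x i - x k) = real n * (xbar n x - x k)"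
    using assms(1) by (simp add: xbar_def sum_subtractf right_diff_distrib)
  then have "(\<Sum>i = 1..n. (x i - x k) / (xbar n x - x k)) = real n"
    using less by (simp flip: sum_divide_distrib)
  then show "(\<Sum>i = 1..n. rel_arg n x k l i) = real n"
    unfolding rel_arg_def sum.distrib sum_distrib_left [symmetric] by (simp add: algebra_simps)
qed

lemma tau_U_in_F_domain:
  assumes "n \<ge> 2" "strict_min_index n x k" "l > 0"
  shows "(l, tau_U n x k l) \<in> F_domain n x"
proof -
  note scaling = tau_U_scaling [OF assms(3) strict_min_index_less_xbar [OF assms(1,2)]]
  have "l * x i + tau_U n x k l > 0" if "i \<in> {1..n}" for i
    unfolding scaling(2) by (rule mult_pos_pos [OF scaling(1) rel_arg_pos [OF assms that]])
  then show ?thesis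
    using assms(3) by (simp add: F_domain_def)
qed

lemma dF_tau_U_neg:
  assumes "n \<ge> 2" "strict_min_index n x k" "l > 0"
  shows "dF n x l (tau_U n x k l) < 0"
proof -
  define t where "t = tau_U n x k l"
  define r where "r = rel_arg n x k l"
  define s where "s = l * (xbar n x - x k) / (1 - exp (- l\<^sup>2))"
  define m where "m = (\<Sum>j = 1..n. ln (r j)) / real n"
  have k: "k \<in> {1..n}"
    using assms(2) by (simp add: strict_min_index_def)
  have s: "s > 0" and y: "\<And>i. l * x i + t = s * r i"
    using tau_U_scaling [OF assms(3) strict_min_index_less_xbar [OF assms(1,2)]]
    by (simp_all add: t_def r_def s_def)
  note r = rel_arg_facts [OF assms, folded r_def]
  \<comment> \<open>The inequality of arithmetic and geometric means for numbers with mean 1, via ln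
    r \<le> r - 1. It is strict because \<open>r k = exp (- l\<^sup>2)\<close> differs from
    1.\<close>
  have "(\<Sum>i = 1..n. ln (r i)) < (\<Sum>i = 1..n. r i - 1)"
  proof (rule sum_strict_mono_ex1)
    show "\<forall>i\<in>{1..n}. ln (r i) \<le> r i - 1"
      using r(3) ln_le_minus_one by blast
    have "r k \<noteq> 1"
      using r(1) assms(3) by simp
    then have "ln (r k) < r k - 1"
      using r(3) [OF k] ln_le_minus_one ln_eq_minus_one by (metis order_less_le)
    then show "\<exists>i\<in>{1..n}. ln (r i) < r i - 1"
      using k by blast
  qed simp
  also have "\<dots> = 0"
    using r(4) by (simp add: sum_subtractf)
  finally have m: "m < 0"
    using assms(1) by (simp add: m_def divide_neg_pos)
  have L: "ln (l * x i + t) = ln s + ln (r i)" if "i \<in> {1..n}" for i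
    using s r(3) [OF that] by (simp add: y ln_mult)
  have "(\<Sum>j = 1..n. ln (l * x j + t)) = (\<Sum>j = 1..n. ln s + ln (r j))"
    by (rule sum.cong) (use L in auto)
  then have mean: "(\<Sum>j = 1..n. ln (l * x j + t)) / real n = ln s + m"
    using assms(1) by (simp add: m_def sum.distrib field_simps)
  have "(\<Sum>i = 1..n. ((\<Sum>j = 1..n. ln (l * x j + t)) / real n - l\<^sup>2 - ln (l * x i + t)) / (l * x i + t)) < 0"
    (is "sum ?f _ < 0")
  proof -
    have "?f i < 0" if i: "i \<in> {1..n}" for i
    proof -
      \<comment> \<open>The term \<open>ln s\<close> cancels in each numerator, leaving
        \<open>m - l\<^sup>2 - ln (r i)\<close>; the lower bound on \<open>r i\<close> reduces its
        sign to \<open>m < 0\<close>.\<close>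
      have "- l\<^sup>2 \<le> ln (r i)"
        using r(2,3) [OF i] by (simp add: ln_ge_iff)
      then have "ln s + m - l\<^sup>2 - ln (l * x i + t) < 0"
        using m by (simp add: L [OF i])
      moreover have "l * x i + t > 0"
        using s r(3) [OF i] by (simp add: y)
      ultimately show ?thesis
        unfolding mean by (rule divide_neg_pos)
    qed
    then have "sum ?f {1..n} < (\<Sum>i = 1..n. 0)"
      using k by (intro sum_strict_mono) auto
    then show ?thesis
      by simp
  qed
  then have "score n x l t < 0"
    using assms(3) by (simp add: score_def divide_neg_pos)
  then show ?thesis
    using dF_eq_score tau_U_in_F_domain [OF assms] assms(1) by (simp add: t_def)
qed

section \<open>Blow-up of the derivative at the left end of the domain\<close>

text \<open>Only \<open>y k t\<close> tends to 0. After multiplication by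
  \<open>l\<^sup>2 * y k t\<close> the score is a convergent part plus
  \<open>- c * ln (y k t)\<close>, which tends to infinity; dividing the positive factor out again
  preserves this.\<close>

lemma filterlim_score_at_right:
  assumes "n \<ge> 2" "strict_min_index n x k" "l > 0"
  shows "filterlim (score n x l) at_top (at_right (- l * x k))"
proof -
  define J where "J = {1..n} - {k}"
  define y where "y = (\<lambda>i t. l * x i + t)"
  define A where "A = (\<lambda>t. \<Sum>i\<in>J. ln (y i t))"
  define W where "W = (\<lambda>t. \<Sum>i\<in>J. 1 / y i t)"
  define B where "B = (\<lambda>t. \<Sum>i\<in>J. (A t / real n - l\<^sup>2 - ln (y i t)) / y i t)"
  \<comment> \<open>The singular logarithm enters its own numerator with weight 1 / n through the
    mean and with weight -1 directly. The net weight is \<open>- c\<close>, and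
    \<open>n \<ge> 2\<close> makes \<open>c\<close> positive.\<close>
  define c where "c = 1 - 1 / real n"
  define a where "a = - l * x k"
  have n: "n > 0"
    using assms(1) by simp
  have c: "c > 0"
    using assms(1) by (simp add: c_def)
  have k: "k \<in> {1..n}" and J: "\<And>i. i \<in> J \<Longrightarrow> y i a > 0"
    using assms(2,3) by (auto simp: strict_min_index_def J_def y_def a_def)
  have split: "(\<Sum>i = 1..n. g i) = g k + (\<Sum>i\<in>J. g i)" for g :: "nat \<Rightarrow> real"
    unfolding J_def using k by (simp add: sum.remove)
  have limy: "(y i \<longlongrightarrow> y i a) (at_right a)" for i
    unfolding y_def by (intro tendsto_intros)
  have limA: "(A \<longlongrightarrow> A a) (at_right a)"
    unfolding A_def by (intro tendsto_intros limy) (use J in force)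
  have limW: "(W \<longlongrightarrow> W a) (at_right a)"
    unfolding W_def by (intro tendsto_intros limy) (use J in force)
  have limB: "(B \<longlongrightarrow> B a) (at_right a)"
    unfolding B_def by (intro tendsto_intros limy limA) (use n J in force)+
  have yk: "filterlim (y k) (at_right 0) (at_right a)"
  proof -
    have "filterlim (\<lambda>t. t - a) (at_right 0) (at_right a)"
      unfolding at_right_to_0 [of a] by (simp add: filterlim_filtermap filterlim_ident)
    then show ?thesis
      by (simp add: y_def a_def add.commute)
  qed
  have "filterlim (\<lambda>u. - c * ln u) at_top (at_right 0)"
    using c by real_asymp
  then have lim1: "filterlim (\<lambda>t. - c * ln (y k t)) at_top (at_right a)"
    by (rule filterlim_compose [OF _ yk])
  \<comment> \<open>Through the mean, the singular logarithm also enters the terms indexed by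
    \<open>J\<close>; the factor \<open>y k t\<close> suppresses it there.\<close>
  have "((\<lambda>u::real. u * ln u) \<longlongrightarrow> 0) (at_right 0)"
    by real_asymp
  then have lim2: "((\<lambda>t. y k t * ln (y k t)) \<longlongrightarrow> 0) (at_right a)"
    by (rule filterlim_compose [OF _ yk])
  have lim3: "((\<lambda>t. A t / real n - l\<^sup>2 + y k t * ln (y k t) * W t / real n + y k t * B t)
      \<longlongrightarrow> A a / real n - l\<^sup>2 + 0 * W a / real n + y k a * B a) (at_right a)"
    by (intro tendsto_intros limA limW limB limy lim2) (use n in auto)
  have lim4: "filterlim (\<lambda>t. (A t / real n - l\<^sup>2 + y k t * ln (y k t) * W t / real n + y k t * B t)
      + - c * ln (y k t)) at_top (at_right a)"
    by (rule filterlim_tendsto_add_at_top [OF lim3 lim1])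
  have "filterlim (\<lambda>u. 1 / (l\<^sup>2 * u)) at_top (at_right 0)"
    using assms(3) by real_asymp
  then have lim5: "filterlim (\<lambda>t. 1 / (l\<^sup>2 * y k t)) at_top (at_right a)"
    by (rule filterlim_compose [OF _ yk])
  have "filterlim (\<lambda>t. ((A t / real n - l\<^sup>2 + y k t * ln (y k t) * W t / real n + y k t * B t)
      + - c * ln (y k t)) * (1 / (l\<^sup>2 * y k t))) at_top (at_right a)"
    by (rule filterlim_at_top_mult_at_top [OF lim4 lim5])
  moreover have "eventually (\<lambda>t. ((A t / real n - l\<^sup>2 + y k t * ln (y k t) * W t / real n + y k t * B t)
      + - c * ln (y k t)) * (1 / (l\<^sup>2 * y k t)) = score n x l t) (at_right a)"
    using eventually_at_right_less
  proof eventually_elim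
    case (elim t)
    define L where "L = ln (y k t)"
    have y: "y k t > 0"
      using elim by (simp add: y_def a_def)
    have m: "(\<Sum>j = 1..n. ln (l * x j + t)) = L + A t"
      unfolding split A_def L_def y_def ..
    have "(\<Sum>i\<in>J. ((L + A t) / real n - l\<^sup>2 - ln (y i t)) / y i t) =
       (\<Sum>i\<in>J. L / real n * (1 / y i t) + (A t / real n - l\<^sup>2 - ln (y i t)) / y i t)"
      by (rule sum.cong) (simp_all add: add_divide_distrib diff_divide_distrib)
    also have "\<dots> = L / real n * W t + B t"
      unfolding W_def B_def sum_distrib_left sum.distrib ..
    finally have "score n x l t = (((L + A t) / real n - l\<^sup>2 - L) / y k t + (L / real n * W t + B t)) / l\<^sup>2"
      unfolding score_def m unfolding split by (simp add: L_def y_def)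
    then show ?case
      using y assms(3) n unfolding L_def [symmetric] c_def by (simp add: field_simps)
  qed
  ultimately show ?thesis
    unfolding a_def by (rule filterlim_cong [OF refl refl, THEN iffD1, rotated])
qed

lemma filterlim_dF_at_right:
  assumes "n \<ge> 2" "strict_min_index n x k" "l > 0"
  shows "filterlim (dF n x l) at_top (at_right (- l * x k))"
proof -
  have "eventually (\<lambda>t. score n x l t = dF n x l t) (at_right (- l * x k))"
    using eventually_at_right_less
  proof eventually_elim
    case (elim t)
    have "0 < l * x i + t" if "i \<in> {1..n}" for i
    proof -
      have "x k \<le> x i"
        using assms(2) that unfolding strict_min_index_def
        by (metis DiffI less_imp_le order_refl singletonD)
      then have "l * x k \<le> l * x i"
        using assms(3) by simp
      then show ?thesis
        using elim by simp
    qed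
    then have "(l, t) \<in> F_domain n x"
      using assms(3) by (simp add: F_domain_def)
    then show ?case
      using dF_eq_score assms(1) by simp
  qed
  then show ?thesis
    using filterlim_score_at_right [OF assms]
    by (rule filterlim_cong [OF refl refl, THEN iffD1])
qed

section \<open>Growth of F along tau_U\<close>

text \<open>The normalised argument at \<open>k\<close> has logarithm \<open>- l\<^sup>2\<close>,
  while the others have positive limits. Hence \<open>F\<close> grows like a positive multiple of
  \<open>l\<^sup>2\<close>, which dominates the logarithm of the scale.\<close>

lemma filterlim_F_tau_U:
  assumes "n \<ge> 2" "strict_min_index n x k"
  shows "filterlim (\<lambda>l. F n x l (tau_U n x k l)) at_top at_top"
proof -
  define J where "J = {1..n} - {k}"
  define d where "d = xbar n x - x k"
  define A where "A = (\<lambda>l. \<Sum>i\<in>J. ln (rel_arg n x k l i))"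
  define B where "B = (\<lambda>l. \<Sum>i\<in>J. (ln (rel_arg n x k l i))\<^sup>2)"
  define N where "N = real n"
  have N: "N > 0"
    using assms(1) by (simp add: N_def)
  have d: "d > 0"
    using strict_min_index_less_xbar [OF assms] by (simp add: d_def)
  have k: "k \<in> {1..n}" and J: "\<And>i. i \<in> J \<Longrightarrow> (x i - x k) / d > 0"
    using assms(2) d by (auto simp: strict_min_index_def J_def)
  have split: "(\<Sum>i = 1..n. g i) = g k + (\<Sum>i\<in>J. g i)" for g :: "nat \<Rightarrow> real"
    unfolding J_def using k by (simp add: sum.remove)
  have limr: "((\<lambda>l. rel_arg n x k l i) \<longlongrightarrow> (x i - x k) / d) at_top" for i
  proof -
    have "((\<lambda>l. exp (- l\<^sup>2) + (1 - exp (- l\<^sup>2)) * ((x i - x k) / d)) \<longlongrightarrow>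
        0 + (1 - 0) * ((x i - x k) / d)) at_top"
      by (intro tendsto_intros; real_asymp)
    then show ?thesis
      by (simp add: rel_arg_def d_def)
  qed
  define a where "a = (\<Sum>i\<in>J. ln ((x i - x k) / d))"
  define b where "b = (\<Sum>i\<in>J. (ln ((x i - x k) / d))\<^sup>2)"
  have limA: "(A \<longlongrightarrow> a) at_top"
    unfolding A_def a_def by (intro tendsto_sum tendsto_ln limr) (use J in force)
  have limB: "(B \<longlongrightarrow> b) at_top"
    unfolding B_def b_def by (intro tendsto_sum tendsto_power tendsto_ln limr) (use J in force)
  have inv: "((\<lambda>l::real. 1 / (2 * l\<^sup>2)) \<longlongrightarrow> 0) at_top"
    by real_asymp
  have lim1: "((\<lambda>l. - A l * (1 + 1 / N) + ((A l)\<^sup>2 / N - B l) * (1 / (2 * l\<^sup>2)))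
      \<longlongrightarrow> - a * (1 + 1 / N) + (a\<^sup>2 / N - b) * 0) at_top"
    by (intro tendsto_intros limA limB inv) (use N in auto)
  \<comment> \<open>The linear part of \<open>F\<close> contributes 1 to the coefficient of
    \<open>l\<^sup>2\<close>, the quadratic part -(1 - 1 / N) / 2.\<close>
  define c where "c = 1 / 2 + 1 / (2 * N)"
  have c: "c > 0"
    using N by (simp add: c_def add_pos_pos)
  have "filterlim (\<lambda>l. l\<^sup>2 * c - N * ln (l * d / (1 - exp (- l\<^sup>2)))) at_top at_top"
    using N d c by real_asymp
  note lim2 = filterlim_tendsto_add_at_top [OF lim1 this]
  have "eventually (\<lambda>l. (- A l * (1 + 1 / N) + ((A l)\<^sup>2 / N - B l) * (1 / (2 * l\<^sup>2))) +
      (l\<^sup>2 * c - N * ln (l * d / (1 - exp (- l\<^sup>2)))) = F n x l (tau_U n x k l)) at_top"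
    using eventually_gt_at_top [of 0]
  proof eventually_elim
    case (elim l)
    define s where "s = l * d / (1 - exp (- l\<^sup>2))"
    note r = rel_arg_facts [OF assms elim]
    have "F n x l (tau_U n x k l) = - centered_ss n (\<lambda>i. ln (rel_arg n x k l i)) / (2 * l\<^sup>2)
        - real n * ln s - (\<Sum>i = 1..n. ln (rel_arg n x k l i))"
      using tau_U_scaling [OF elim strict_min_index_less_xbar [OF assms]] r(3) assms(1)
      unfolding s_def d_def by (intro F_scaled) auto
    also have "\<dots> = - ((- l\<^sup>2)\<^sup>2 + B l - (- l\<^sup>2 + A l)\<^sup>2 / N) / (2 * l\<^sup>2) - N * ln s - (- l\<^sup>2 + A l)"
      unfolding centered_ss_def split A_def B_def r(1) N_def by simp
    also have "\<dots> = (- A l * (1 + 1 / N) + ((A l)\<^sup>2 / N - B l) * (1 / (2 * l\<^sup>2))) + (l\<^sup>2 * c - N * ln s)"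
      using elim N by (simp add: c_def field_simps power2_eq_square)
    finally show ?case
      by (simp add: s_def)
  qed
  then show ?thesis
    using lim2 by (rule filterlim_cong [OF refl refl, THEN iffD1])
qed

section \<open>The limit at l = 0 and its maximum\<close>

text \<open>Extracting the scale \<open>t\<close> leaves the logarithms of 1 + l * (x i / t).
  Homogeneity of \<open>centered_ss\<close> moves the factor 1 / l^2 inside, where it produces
  difference quotients with limits \<open>x i / t\<close>.\<close>

lemma tendsto_F_at_0:
  assumes "n > 0" "t > 0"
  shows "((\<lambda>l. F n x l t) \<longlongrightarrow> - centered_ss n x / (2 * t\<^sup>2) - real n * ln t) (at 0)"
proof -
  have L: "((\<lambda>l. ln (1 + l * (x i / t)) / l) \<longlongrightarrow> x i / t) (at 0)" for i
  proof -
    have "((\<lambda>l. ln (1 + l * (x i / t))) has_real_derivative x i / t) (at 0)"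
      using assms(2) by (auto intro!: derivative_eq_intros)
    then show ?thesis
      by (simp add: DERIV_def)
  qed
  have S: "((\<lambda>l. \<Sum>i = 1..n. ln (1 + l * (x i / t))) \<longlongrightarrow> (\<Sum>i = 1..n. ln (1 + 0 * (x i / t)))) (at 0)"
    by (intro tendsto_intros) auto
  have "((\<lambda>l. - centered_ss n (\<lambda>i. ln (1 + l * (x i / t)) / l) / 2 - real n * ln t
      - (\<Sum>i = 1..n. ln (1 + l * (x i / t)))) \<longlongrightarrow>
      - centered_ss n (\<lambda>i. x i / t) / 2 - real n * ln t - (\<Sum>i = 1..n. ln (1 + 0 * (x i / t)))) (at 0)"
    unfolding centered_ss_def by (intro tendsto_intros L S) (use assms(1) in auto)
  moreover have "centered_ss n (\<lambda>i. x i / t) = centered_ss n x / t\<^sup>2"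
    using centered_ss_scale [of n "1 / t" x] by (simp add: power_divide)
  moreover have "eventually (\<lambda>l. - centered_ss n (\<lambda>i. ln (1 + l * (x i / t)) / l) / 2 - real n * ln t
      - (\<Sum>i = 1..n. ln (1 + l * (x i / t))) = F n x l t) (at 0)"
  proof -
    have "eventually (\<lambda>l. 0 < 1 + l * (x i / t)) (at 0)" for i
    proof -
      have "((\<lambda>l. 1 + l * (x i / t)) \<longlongrightarrow> 1 + 0 * (x i / t)) (at 0)"
        by (intro tendsto_intros)
      then show ?thesis
        by (rule order_tendstoD) simp
    qed
    then have "eventually (\<lambda>l. \<forall>i\<in>{1..n}. 0 < 1 + l * (x i / t)) (at 0)"
      by (intro eventually_ball_finite) auto
    then show ?thesis
      using eventually_neq_at_within [of 0]
    proof eventually_elim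
      case (elim l)
      have "F n x l t = - centered_ss n (\<lambda>i. ln (1 + l * (x i / t))) / (2 * l\<^sup>2) - real n * ln t
          - (\<Sum>i = 1..n. ln (1 + l * (x i / t)))"
        by (rule F_scaled) (use assms elim in \<open>auto simp: field_simps\<close>)
      then show ?case
        using centered_ss_scale [of n "1 / l" "\<lambda>i. ln (1 + l * (x i / t))"]
        by (simp add: power_divide)
    qed
  qed
  ultimately show ?thesis
    by (simp add: tendsto_cong mult.commute)
qed

lemma F0_eq:
  assumes "n > 0" "t > 0"
  shows "F0 n x t = - centered_ss n x / (2 * t\<^sup>2) - real n * ln t"
  unfolding F0_def by (rule tendsto_Lim) (use tendsto_F_at_0 [OF assms] in auto)

lemma tau_star_pos:
  assumes "n > 0" "centered_ss n x > 0"
  shows "tau_star n x > 0"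
proof -
  have "(tau_star n x)\<^sup>2 > 0"
    using tau_star_square [OF assms(1)] assms by simp
  moreover have "tau_star n x \<ge> 0"
    unfolding tau_star_def by (intro mult_nonneg_nonneg real_sqrt_ge_zero sum_nonneg) auto
  ultimately show ?thesis
    by (simp add: zero_less_power2)
qed

text \<open>With u = \<open>tau_star n x\<close> the spread of the data is n * u^2, and the claim
  becomes ln z \<le> z - 1 at z = (u / t)^2. The maximum is thus global on the positive
  axis.\<close>

lemma F0_le_tau_star:
  assumes "n > 0" "centered_ss n x > 0" "t > 0"
  shows "F0 n x t \<le> F0 n x (tau_star n x)"
proof -
  define V where "V = centered_ss n x"
  define u where "u = tau_star n x"
  have u: "u > 0"
    using tau_star_pos assms(1,2) by (simp add: u_def)
  have u2: "u\<^sup>2 = V / real n"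
    using tau_star_square [OF assms(1)] by (simp add: u_def V_def)
  have Vn: "V = real n * u\<^sup>2"
    using u2 assms(1) by simp
  have "ln ((u / t)\<^sup>2) \<le> (u / t)\<^sup>2 - 1"
    using u assms(3) by (intro ln_le_minus_one) simp
  then have "2 * (ln u - ln t) \<le> (u / t)\<^sup>2 - 1"
    using u assms(3) by (simp add: ln_realpow ln_div)
  then have "real n * (2 * (ln u - ln t)) \<le> real n * ((u / t)\<^sup>2 - 1)"
    by (rule mult_left_mono) simp
  moreover have "F0 n x t = - real n * (u / t)\<^sup>2 / 2 - real n * ln t"
    using F0_eq [OF assms(1,3), of x] by (simp add: V_def [symmetric] Vn power_divide)
  moreover have "F0 n x u = - real n / 2 - real n * ln u"
    using F0_eq [OF assms(1) u, of x] u by (simp add: V_def [symmetric] Vn)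
  ultimately show "F0 n x t \<le> F0 n x (tau_star n x)"
    by (simp add: u_def [symmetric] algebra_simps)
qed

section \<open>Reflection of the data, for negative l\<close>

text \<open>\<open>F\<close> depends on \<open>l\<close> and \<open>x\<close> only through
  \<open>l\<^sup>2\<close> and the products \<open>l * x i\<close>.\<close>

lemma F_reflect: "F n (\<lambda>i. - x i) (- l) = F n x l"
  unfolding F_def [abs_def] minus_mult_minus by simp

lemma dF_reflect: "dF n (\<lambda>i. - x i) (- l) = dF n x l"
  by (simp add: dF_def [abs_def] F_reflect)

lemma F_domain_reflect: "(- l, t) \<in> F_domain n (\<lambda>i. - x i) \<longleftrightarrow> (l, t) \<in> F_domain n x"
  by (simp add: F_domain_def real_0_less_add_iff)

text \<open>Negation turns the largest datum \<open>x 1\<close> into the smallest, hence the index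
  1.\<close>

lemma tau_U_reflect: "tau_U n (\<lambda>i. - x i) 1 (- l) = tau_U_minus n x l"
proof -
  have "xbar n (\<lambda>i. - x i) = - xbar n x"
    by (simp add: xbar_def sum_negf)
  moreover have "- x 1 - - xbar n x * exp (- l\<^sup>2) = - (x 1 - xbar n x * exp (- l\<^sup>2))"
    by simp
  ultimately show ?thesis
    unfolding tau_U_def tau_U_minus_def
    by (simp only: power2_minus minus_minus minus_divide_left [symmetric] mult_minus_left
        mult_minus_right)
qed

section \<open>Consequences of the ordering, and assembly\<close>

lemma ordered_data_bounds:
  assumes "n \<ge> 2" "ordered_data n x"
  shows "i \<in> {1..n} - {n} \<Longrightarrow> x n < x i" and "i \<in> {1..n} - {1} \<Longrightarrow> x i < x 1"
proof -
  have x12: "x 1 > x 2" and xn: "x (n - 1) > x n"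
    and mono: "\<And>i. 2 \<le> i \<Longrightarrow> i + 1 \<le> n - 1 \<Longrightarrow> x i \<ge> x (i + 1)"
    using assms(2) by (auto simp: ordered_data_def)
  have Suc_le: "x (Suc i) \<le> x i" if "1 \<le> i" "i < n" for i
  proof -
    \<comment> \<open>The two end gaps are the strict inequalities of \<open>ordered_data\<close>,
      the inner gaps its weak ones; for \<open>n = 2\<close> the two end gaps coincide.\<close>
    consider "i = 1" | "i = n - 1" | "2 \<le> i" "i + 1 \<le> n - 1"
      using \<open>1 \<le> i\<close> \<open>i < n\<close> by linarith
    then show ?thesis
    proof cases
      case 1
      then show ?thesis using x12 by (simp add: numeral_2_eq_2)
    next
      case 2
      then show ?thesis using xn that by simp
    next
      case 3
      then show ?thesis using mono by simp
    qed
  qed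
  have dec: "x j \<le> x i" if "i \<le> j" "1 \<le> i" "j \<le> n" for i j
    using that
  proof (induction j rule: dec_induct)
    case (step j)
    then show ?case
      using Suc_le [of j] by simp
  qed simp
  \<comment> \<open>Weak descent from \<open>i\<close> to \<open>n - 1\<close> is followed by the
    strict last gap; the next claim uses the strict first gap in the same way.\<close>
  show "x n < x i" if "i \<in> {1..n} - {n}"
    using dec [of i "n - 1"] xn that by force
  show "x i < x 1" if "i \<in> {1..n} - {1}"
    using dec [of 2 i] x12 that by force
qed

theorem mainTheorem1:
  fixes n :: nat and x :: "nat \<Rightarrow> real"
  assumes "n \<ge> 2" and "ordered_data n x"
  shows
    "((\<forall>l > 0. (l, tau_U_plus n x l) \<in> F_domain n x \<and> dF n x l (tau_U_plus n x l) < 0) \<and>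
      (\<forall>l < 0. (l, tau_U_minus n x l) \<in> F_domain n x \<and> dF n x l (tau_U_minus n x l) < 0)) \<and>
     ((\<forall>l > 0. filterlim (dF n x l) at_top (at_right (- l * x n))) \<and>
      (\<forall>l < 0. filterlim (dF n x l) at_top (at_right (- l * x 1)))) \<and>
     (\<forall>(l, t) \<in> F_domain n x. ddF n x l t = 0 \<longrightarrow> dF n x l t < 0) \<and>
     (filterlim (\<lambda>l. F n x l (tau_U_plus n x l)) at_top at_top \<and>
      filterlim (\<lambda>l. F n x l (tau_U_minus n x l)) at_top at_bot) \<and>
     ((\<forall>t > 0. ((\<lambda>l. F n x l t) \<longlongrightarrow> F0 n x t) (at 0)) \<and>
      relative_max_at {0<..} (F0 n x) (tau_star n x))"
proof -
  have n: "n > 0"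
    using assms(1) by simp
  have min_n: "strict_min_index n x n"
    using assms(1) ordered_data_bounds(1) [OF assms] by (auto simp: strict_min_index_def)
  have min_1: "strict_min_index n (\<lambda>i. - x i) 1"
    using assms(1) ordered_data_bounds(2) [OF assms] by (auto simp: strict_min_index_def)
  have plus: "tau_U_plus n x = tau_U n x n"
    by (simp add: fun_eq_iff tau_U_plus_def tau_U_def)
  have ne: "x 1 \<noteq> x n"
    using ordered_data_bounds(1) [OF assms, of 1] assms(1) by auto
  have one: "1 \<in> {1..n}" and nn: "n \<in> {1..n}"
    using assms(1) by auto
  have part1: "\<forall>l > 0. (l, tau_U_plus n x l) \<in> F_domain n x \<and> dF n x l (tau_U_plus n x l) < 0"
    using tau_U_in_F_domain [OF assms(1) min_n] dF_tau_U_neg [OF assms(1) min_n]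
    by (simp add: plus)
  have part1': "\<forall>l < 0. (l, tau_U_minus n x l) \<in> F_domain n x \<and> dF n x l (tau_U_minus n x l) < 0"
  proof (intro allI impI)
    fix l :: real assume "l < 0"
    then show "(l, tau_U_minus n x l) \<in> F_domain n x \<and> dF n x l (tau_U_minus n x l) < 0"
      using tau_U_in_F_domain [OF assms(1) min_1, of "- l"] dF_tau_U_neg [OF assms(1) min_1, of "- l"]
      unfolding tau_U_reflect dF_reflect F_domain_reflect by simp
  qed
  have part2: "\<forall>l > 0. filterlim (dF n x l) at_top (at_right (- l * x n))"
    using filterlim_dF_at_right [OF assms(1) min_n] by blast
  have part2': "\<forall>l < 0. filterlim (dF n x l) at_top (at_right (- l * x 1))"
  proof (intro allI impI)
    fix l :: real assume "l < 0"
    then show "filterlim (dF n x l) at_top (at_right (- l * x 1))"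
      using filterlim_dF_at_right [OF assms(1) min_1, of "- l"] unfolding dF_reflect by simp
  qed
  have part3: "\<forall>(l, t) \<in> F_domain n x. ddF n x l t = 0 \<longrightarrow> dF n x l t < 0"
    using score_neg_if_ddF_zero [OF n _ one nn ne] dF_eq_score [OF n] by fastforce
  have part4: "filterlim (\<lambda>l. F n x l (tau_U_plus n x l)) at_top at_top"
    unfolding plus by (rule filterlim_F_tau_U [OF assms(1) min_n])
  have part4': "filterlim (\<lambda>l. F n x l (tau_U_minus n x l)) at_top at_bot"
  proof -
    \<comment> \<open>Reflection carries the curve for negative \<open>l\<close> to the one for
      positive \<open>l\<close>, so the limit at minus infinity becomes one at plus
      infinity.\<close>
    have "F n (\<lambda>i. - x i) l (tau_U n (\<lambda>i. - x i) 1 l) = F n x (- l) (tau_U_minus n x (- l))" for l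
      using tau_U_reflect [of n x "- l"] F_reflect [of n x "- l"] by simp
    then show ?thesis
      using filterlim_F_tau_U [OF assms(1) min_1] by (simp add: filterlim_at_bot_mirror)
  qed
  have part5: "\<forall>t > 0. ((\<lambda>l. F n x l t) \<longlongrightarrow> F0 n x t) (at 0)"
    using tendsto_F_at_0 [OF n] F0_eq [OF n] by simp
  have V: "centered_ss n x > 0"
    by (rule centered_ss_pos [OF n one nn ne])
  have part5': "relative_max_at {0<..} (F0 n x) (tau_star n x)"
    unfolding relative_max_at_def
    \<comment> \<open>The bound is global, so the radius 1 is an arbitrary choice.\<close>
    using F0_le_tau_star [OF n V] tau_star_pos [OF n V] zero_less_one by (auto intro!: exI [of _ 1])
  show ?thesis
    by (intro conjI part1 part1' part2 part2' part3 part4 part4' part5 part5')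
qed

end
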